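(* Let $(X,D,K)$ be a metric type space and let $F:X\times X\to X$ and $g:X\to X$ be maps such that for all $x,y,u,v\in X$ $$D(F(x,y),F(u,v))\le\alpha_1D(gx,gu)+\alpha_2D(F(x,y),gx)+\alpha_3D(gy,gv)+\alpha_4D(F(u,v),gu)+\alpha_5D(F(x,y),gu)+\alpha_6D(F(u,v),gx),$$ where $\alpha_1,\dots,\alpha_6$ are nonnegative constants with $$2K(\alpha_1+\alpha_3)+(K+1)(\alpha_2+\alpha_4)+(K^2+K)(\alpha_5+\alpha_6)<2.$$ If $F(X\times X)\subset g(X)$ and $g(X)$ is complete, then $F$ and $g$ have a coupled coincidence point in $X$.
   Context: A metric type space $(X,D,K)$ consists of a nonempty set $X$, a function $D:X\times X\to[0,\infty)$ and a constant $K\ge 1$ such that: (D1) $D(x,x)=0$ for all $x\in X$, and $D(x,y)=0$ implies $x=y$; (D2) $D(x,y)=D(y,x)$ for all $x,y\in X$; (D3) $D(x,y)\le K\big(D(x,z_1)+D(z_1,z_2)+\cdots+D(z_n,y)\big)$ for all $x,y,z_1,\dots,z_n\in X$, where $n\ge1$ is a fixed natural number. Convergence and Cauchy sequences are defined as for metric spaces: $x_m\to x$ means $D(x_m,x)\to0$; $(x_m)$ is Cauchy if $D(x_m,x_k)\to0$ as $m,k\to\infty$; $g(X)$ is complete if every Cauchy sequence in $g(X)$ converges to a point of $g(X)$. We write $gx$ for $g(x)$. An element $(x,y)\in X\times X$ is a coupled coincidence point of $F$ and $g$ if $F(x,y)=g(x)$ and $F(y,x)=g(y)$. *)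

theory Defs
  imports Complex_Main "HOL-Library.FuncSet"
begin

text \<open>
  The constant \<open>n\<close>, the number of intermediate points in the relaxed triangle inequality,
  is fixed together with the space.
\<close>

locale metric_type_space =
  fixes X :: "'a set" and D :: "'a \<Rightarrow> 'a \<Rightarrow> real" and K :: real and n :: nat
  assumes nonempty: "X \<noteq> {}"
    and K_ge_1: "1 \<le> K"
    and n_ge_1: "1 \<le> n"
    and nonneg: "\<And>x y. x \<in> X \<Longrightarrow> y \<in> X \<Longrightarrow> 0 \<le> D x y"
    and zero: "\<And>x. x \<in> X \<Longrightarrow> D x x = 0"
    and eq_if_zero: "\<And>x y. x \<in> X \<Longrightarrow> y \<in> X \<Longrightarrow> D x y = 0 \<Longrightarrow> x = y"
    and commute: "\<And>x y. x \<in> X \<Longrightarrow> y \<in> X \<Longrightarrow> D x y = D y x"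
    and polygon: "\<And>x y z. x \<in> X \<Longrightarrow> y \<in> X \<Longrightarrow> z \<in> {1..n} \<rightarrow> X \<Longrightarrow>
      D x y \<le> K * (D x (z 1) + (\<Sum>i = 1..<n. D (z i) (z (Suc i))) + D (z n) y)"

definition converges_to :: "('a \<Rightarrow> 'a \<Rightarrow> real) \<Rightarrow> (nat \<Rightarrow> 'a) \<Rightarrow> 'a \<Rightarrow> bool" where
  "converges_to D \<sigma> x \<longleftrightarrow> (\<lambda>m. D (\<sigma> m) x) \<longlonglongrightarrow> 0"

definition Cauchy_seq :: "('a \<Rightarrow> 'a \<Rightarrow> real) \<Rightarrow> (nat \<Rightarrow> 'a) \<Rightarrow> bool" where
  "Cauchy_seq D \<sigma> \<longleftrightarrow> (\<forall>\<epsilon>>0. \<exists>N. \<forall>m\<ge>N. \<forall>k\<ge>N. D (\<sigma> m) (\<sigma> k) < \<epsilon>)"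

definition complete_subset :: "('a \<Rightarrow> 'a \<Rightarrow> real) \<Rightarrow> 'a set \<Rightarrow> bool" where
  "complete_subset D S \<longleftrightarrow>
    (\<forall>\<sigma>. range \<sigma> \<subseteq> S \<and> Cauchy_seq D \<sigma> \<longrightarrow> (\<exists>x\<in>S. converges_to D \<sigma> x))"

definition coupled_coincidence_point ::
    "'a set \<Rightarrow> ('a \<times> 'a \<Rightarrow> 'a) \<Rightarrow> ('a \<Rightarrow> 'a) \<Rightarrow> 'a \<times> 'a \<Rightarrow> bool" where
  "coupled_coincidence_point X F g = (\<lambda>(x, y).
    (x, y) \<in> X \<times> X \<and> F (x, y) = g x \<and> F (y, x) = g y)"

end

theory Submission
  imports Defs
begin

text \<open>
  Iterating \<open>F\<close> through \<open>g\<close> gives points with \<open>g x\<^bsub>m+1\<^esub> = F (x\<^bsub>m\<^esub>, y\<^bsub>m\<^esub>)\<close> and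
  \<open>g y\<^bsub>m+1\<^esub> = F (y\<^bsub>m\<^esub>, x\<^bsub>m\<^esub>)\<close>. The right-hand side of the contractive condition is not symmetric
  in the two arguments of \<open>F\<close> that are compared, but the left-hand side is; adding the two
  instances makes everything depend only on \<open>a = \<alpha>\<^sub>1 + \<alpha>\<^sub>3\<close>, \<open>b = \<alpha>\<^sub>2 + \<alpha>\<^sub>4\<close> and \<open>c = \<alpha>\<^sub>5 + \<alpha>\<^sub>6\<close>
  (lemma \<open>symmetric_contraction\<close>).

  Neither coordinate sequence need contract by itself, since each step of \<open>g x\<close> is bounded by
  steps of both \<open>g x\<close> and \<open>g y\<close>. The sum \<open>d\<^bsub>m\<^esub>\<close> of the two steps does contract:
  \<open>(2 - b - K c) d\<^bsub>m+1\<^esub> \<le> (2 a + b + K c) d\<^bsub>m\<^esub>\<close>. The numerical hypothesis says exactly that the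
  resulting ratio \<open>r\<close> satisfies \<open>K r < 1\<close>. Each use of the relaxed triangle inequality costs a
  factor \<open>K\<close>, so this is what makes the series that bounds \<open>D (g x\<^bsub>m\<^esub>) (g x\<^bsub>k\<^esub>)\<close> converge
  (lemma \<open>Cauchy_if_geometric_steps\<close>).

  By completeness both coordinates converge, to \<open>g x\<close> and \<open>g y\<close> say. Comparing \<open>F (x, y)\<close> with
  \<open>F (x\<^bsub>m\<^esub>, y\<^bsub>m\<^esub>)\<close> and letting \<open>m\<close> grow, all terms vanish except multiples of
  \<open>\<Delta> = D (F (x, y)) (g x)\<close>, and what remains is \<open>2 \<Delta> \<le> (K b + K\<^sup>2 c) \<Delta>\<close>, where the coefficient
  on the right is less than 2. Hence \<open>F (x, y) = g x\<close>, and the other equation follows by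
  exchanging the coordinates.
\<close>

section \<open>Paths in metric type spaces\<close>

context metric_type_space
begin

lemma relaxed_triangle:
  assumes "x \<in> X" "y \<in> X" "z \<in> X"
  shows "D x y \<le> K * (D x z + D z y)"
  \<comment> \<open>The polygon whose intermediate points all coincide.\<close>
  using polygon[of x y "\<lambda>_. z"] assms zero by simp

text \<open>
  A path is unfolded from its first point, so that the step at distance \<open>i\<close> from the start
  carries the weight \<open>K\<^bsup>i+1\<^esup>\<close>. The weighted steps are then dominated by a geometric series of
  ratio \<open>K * r\<close>.
\<close>

lemma geometric_steps_bound:
  assumes X: "\<And>m. \<sigma> m \<in> X"
    and step: "\<And>m. D (\<sigma> m) (\<sigma> (Suc m)) \<le> B * r ^ m"
    and "0 \<le> B" "0 \<le> r" "K * r < 1"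
  shows "D (\<sigma> m) (\<sigma> (m + p)) \<le> K * B * r ^ m / (1 - K * r)"
proof (induction p arbitrary: m)
  case 0
  show ?case using assms K_ge_1 zero[OF X] by simp
next
  case (Suc p)
  have "D (\<sigma> m) (\<sigma> (m + Suc p))
      \<le> K * (D (\<sigma> m) (\<sigma> (Suc m)) + D (\<sigma> (Suc m)) (\<sigma> (Suc m + p)))"
    using relaxed_triangle[OF X X X, of m "m + Suc p" "Suc m"] by simp
  also have "\<dots> \<le> K * (B * r ^ m + K * B * r ^ Suc m / (1 - K * r))"
    using K_ge_1 by (intro mult_left_mono add_mono step Suc.IH) simp
  also have "\<dots> = K * B * r ^ m / (1 - K * r)"
    using assms(5) by (simp add: field_simps)
  finally show ?case .
qed

lemma Cauchy_if_geometric_steps: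
  assumes X: "\<And>m. \<sigma> m \<in> X"
    and "\<And>m. D (\<sigma> m) (\<sigma> (Suc m)) \<le> B * r ^ m"
    and "0 \<le> B" "0 \<le> r" "K * r < 1"
  shows "Cauchy_seq D \<sigma>"
  unfolding Cauchy_seq_def
proof (intro allI impI)
  fix \<epsilon> :: real
  assume \<epsilon>: "0 < \<epsilon>"
  define h where "h m = K * B * r ^ m / (1 - K * r)" for m
  have bound: "D (\<sigma> m) (\<sigma> k) \<le> h m" if "m \<le> k" for m k
    using geometric_steps_bound[OF assms, of m "k - m"] that by (simp add: h_def)
  have "r \<le> K * r"
    using mult_right_mono[OF K_ge_1 \<open>0 \<le> r\<close>] by simp
  then have "r < 1"
    using assms(5) by simp
  then have "(\<lambda>m. r ^ m) \<longlonglongrightarrow> 0"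
    using \<open>0 \<le> r\<close> by (intro LIMSEQ_realpow_zero)
  then have "(\<lambda>m. K * B / (1 - K * r) * r ^ m) \<longlonglongrightarrow> K * B / (1 - K * r) * 0"
    by (intro tendsto_mult tendsto_const)
  then have "h \<longlonglongrightarrow> 0"
    by (simp add: h_def[abs_def])
  from order_tendstoD(2)[OF this \<epsilon>] obtain N where N: "\<And>m. m \<ge> N \<Longrightarrow> h m < \<epsilon>"
    unfolding eventually_sequentially by blast
  have "D (\<sigma> m) (\<sigma> k) < \<epsilon>" if "m \<ge> N" "k \<ge> N" for m k
  proof (cases "m \<le> k")
    case True
    then show ?thesis using bound[of m k] N[of m] that by simp
  next
    case False
    then show ?thesis using bound[of k m] N[of k] that commute[OF X X, of m k] by simp
  qed
  then show "\<exists>N. \<forall>m\<ge>N. \<forall>k\<ge>N. D (\<sigma> m) (\<sigma> k) < \<epsilon>"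
    by blast
qed

end

section \<open>Contraction of the coupled iteration\<close>

locale coupled_contraction = metric_type_space X D K n
  for X :: "'a set" and D :: "'a \<Rightarrow> 'a \<Rightarrow> real" and K :: real and n :: nat +
  fixes F :: "'a \<times> 'a \<Rightarrow> 'a" and g :: "'a \<Rightarrow> 'a"
    and \<alpha>\<^sub>1 \<alpha>\<^sub>2 \<alpha>\<^sub>3 \<alpha>\<^sub>4 \<alpha>\<^sub>5 \<alpha>\<^sub>6 :: real
  assumes F_in: "F \<in> X \<times> X \<rightarrow> X" and g_in: "g \<in> X \<rightarrow> X"
    and coeffs_nonneg: "0 \<le> \<alpha>\<^sub>1" "0 \<le> \<alpha>\<^sub>2" "0 \<le> \<alpha>\<^sub>3" "0 \<le> \<alpha>\<^sub>4" "0 \<le> \<alpha>\<^sub>5" "0 \<le> \<alpha>\<^sub>6"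
    and coeffs_small:
      "2 * K * (\<alpha>\<^sub>1 + \<alpha>\<^sub>3) + (K + 1) * (\<alpha>\<^sub>2 + \<alpha>\<^sub>4) + (K\<^sup>2 + K) * (\<alpha>\<^sub>5 + \<alpha>\<^sub>6) < 2"
    and contraction: "\<And>x y u v. x \<in> X \<Longrightarrow> y \<in> X \<Longrightarrow> u \<in> X \<Longrightarrow> v \<in> X \<Longrightarrow>
      D (F (x, y)) (F (u, v)) \<le> \<alpha>\<^sub>1 * D (g x) (g u) + \<alpha>\<^sub>2 * D (F (x, y)) (g x)
        + \<alpha>\<^sub>3 * D (g y) (g v) + \<alpha>\<^sub>4 * D (F (u, v)) (g u)
        + \<alpha>\<^sub>5 * D (F (x, y)) (g u) + \<alpha>\<^sub>6 * D (F (u, v)) (g x)"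
begin

abbreviation "b \<equiv> \<alpha>\<^sub>2 + \<alpha>\<^sub>4"

abbreviation "c \<equiv> \<alpha>\<^sub>5 + \<alpha>\<^sub>6"

lemma in_X [simp]: "x \<in> X \<Longrightarrow> g x \<in> X" "x \<in> X \<Longrightarrow> y \<in> X \<Longrightarrow> F (x, y) \<in> X"
  using F_in g_in by auto

lemma symmetric_contraction:
  assumes X: "x \<in> X" "y \<in> X" "u \<in> X" "v \<in> X"
  shows "2 * D (F (x, y)) (F (u, v)) \<le> 2 * \<alpha>\<^sub>1 * D (g x) (g u) + 2 * \<alpha>\<^sub>3 * D (g y) (g v)
      + b * (D (F (x, y)) (g x) + D (F (u, v)) (g u))
      + c * (D (F (x, y)) (g u) + D (F (u, v)) (g x))"
proof -
  have "D (F (u, v)) (F (x, y)) = D (F (x, y)) (F (u, v))"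
    "D (g u) (g x) = D (g x) (g u)" "D (g v) (g y) = D (g y) (g v)"
    using X by (simp_all add: commute)
  then show ?thesis
    using contraction[of x y u v] contraction[of u v x y] X
    by (simp add: algebra_simps)
qed

text \<open>
  The coefficient left over when \<open>F (x, y)\<close> is compared with the limit point \<open>g x\<close>. Since
  \<open>K \<ge> 1\<close>, it also bounds \<open>b + K * c\<close>, so that the denominator of the contraction ratio is
  positive.
\<close>

lemma limit_coeff_less: "K * (b + K * c) < 2"
proof -
  have "0 \<le> 2 * K * (\<alpha>\<^sub>1 + \<alpha>\<^sub>3) + b + K * c"
    using K_ge_1 coeffs_nonneg by simp
  then show ?thesis
    using coeffs_small by (simp add: algebra_simps power2_eq_square)
qed

definition ratio :: real where
  "ratio = (2 * (\<alpha>\<^sub>1 + \<alpha>\<^sub>3) + b + K * c) / (2 - (b + K * c))"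

lemma ratio_denominator_pos: "b + K * c < 2"
proof -
  have "0 \<le> b + K * c"
    using K_ge_1 coeffs_nonneg by simp
  from mult_right_mono[OF K_ge_1 this] show ?thesis
    using limit_coeff_less by simp
qed

lemma ratio_nonneg: "0 \<le> ratio"
  using K_ge_1 coeffs_nonneg ratio_denominator_pos by (simp add: ratio_def)

lemma K_ratio_less_1: "K * ratio < 1"
proof -
  have "K * (2 * (\<alpha>\<^sub>1 + \<alpha>\<^sub>3) + b + K * c) < 2 - (b + K * c)"
    using coeffs_small by (simp add: algebra_simps power2_eq_square)
  then show ?thesis
    using ratio_denominator_pos by (simp add: ratio_def)
qed

text \<open>
  One coordinate of the contraction of steps, where \<open>(x, y)\<close>, \<open>(x', y')\<close> are consecutive iterates
  and \<open>F (x', y')\<close> is the \<open>g\<close>-image of the next one. Of the two cross terms weighted by \<open>c\<close>, the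
  one between \<open>F (x, y)\<close> and \<open>g x' = F (x, y)\<close> vanishes, and the other spans two steps.
\<close>

lemma coordinate_step:
  assumes X: "x \<in> X" "y \<in> X" "x' \<in> X" "y' \<in> X" and x': "g x' = F (x, y)"
  shows "2 * D (g x') (F (x', y')) \<le> 2 * \<alpha>\<^sub>1 * D (g x) (g x') + 2 * \<alpha>\<^sub>3 * D (g y) (g y')
      + (b + K * c) * (D (g x) (g x') + D (g x') (F (x', y')))"
proof -
  have "D (F (x', y')) (g x) \<le> K * (D (g x) (g x') + D (g x') (F (x', y')))"
    using relaxed_triangle[of "g x" "F (x', y')" "g x'"] X by (simp add: commute)
  then have "c * D (F (x', y')) (g x) \<le> c * (K * (D (g x) (g x') + D (g x') (F (x', y'))))"
    using coeffs_nonneg by (intro mult_left_mono) simp_all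
  moreover have "2 * D (g x') (F (x', y')) \<le> 2 * \<alpha>\<^sub>1 * D (g x) (g x') + 2 * \<alpha>\<^sub>3 * D (g y) (g y')
      + b * (D (g x) (g x') + D (g x') (F (x', y'))) + c * D (F (x', y')) (g x)"
    using symmetric_contraction[OF X] X
    by (simp add: x'[symmetric] zero commute[of "g x'" "g x"] commute[of "F (x', y')" "g x'"])
  ultimately show ?thesis
    by (simp add: algebra_simps)
qed

lemma step_sum_contracts:
  assumes X: "x \<in> X" "y \<in> X" "x' \<in> X" "y' \<in> X"
    and x': "g x' = F (x, y)" and y': "g y' = F (y, x)"
  shows "D (g x') (F (x', y')) + D (g y') (F (y', x'))
      \<le> ratio * (D (g x) (g x') + D (g y) (g y'))"
proof -
  let ?d = "D (g x) (g x') + D (g y) (g y')"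
  let ?d' = "D (g x') (F (x', y')) + D (g y') (F (y', x'))"
  have "(2 - (b + K * c)) * ?d' \<le> (2 * (\<alpha>\<^sub>1 + \<alpha>\<^sub>3) + b + K * c) * ?d"
    using coordinate_step[OF X x'] coordinate_step[OF X(2,1,4,3) y']
    by (simp add: algebra_simps)
  then show ?thesis
    using ratio_denominator_pos by (simp add: ratio_def field_simps)
qed

section \<open>The limit is a coupled coincidence point\<close>

text \<open>
  The pair \<open>(g x, g y)\<close> is the limit of the iterates \<open>(g x\<^bsub>m\<^esub>, g y\<^bsub>m\<^esub>)\<close>. No continuity of \<open>D\<close> is
  available, so \<open>D (F (x, y)) (g x)\<close> cannot be obtained as the limit of the distances
  \<open>D (F (x, y)) (g x\<^bsub>m\<^esub>)\<close>. Instead it is bounded, at each \<open>m\<close>, by an expression in itself and the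
  distances of the iterates from their limits, and only this bound is passed to the limit.
\<close>

lemma coincidence_in_limit:
  assumes X: "x \<in> X" "y \<in> X" "\<And>m. xs m \<in> X" "\<And>m. ys m \<in> X"
    and xs: "\<And>m. g (xs (Suc m)) = F (xs m, ys m)"
    and x_lim: "converges_to D (\<lambda>m. g (xs m)) (g x)"
    and y_lim: "converges_to D (\<lambda>m. g (ys m)) (g y)"
  shows "F (x, y) = g x"
proof -
  define \<Delta> where "\<Delta> = D (F (x, y)) (g x)"
  define e where "e m = D (g (xs m)) (g x)" for m
  define f where "f m = D (g (ys m)) (g y)" for m
  have e: "e \<longlonglongrightarrow> 0" and f: "f \<longlonglongrightarrow> 0"
    using x_lim y_lim unfolding converges_to_def e_def[abs_def] f_def[abs_def] .
  note e_Suc = LIMSEQ_Suc[OF e]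
  define h where "h m = K * (2 * \<alpha>\<^sub>1 * e m + 2 * \<alpha>\<^sub>3 * f m + b * (\<Delta> + K * (e (Suc m) + e m))
      + c * (K * (\<Delta> + e m) + e (Suc m))) + 2 * K * e (Suc m)" for m
  have "2 * \<Delta> \<le> h m" for m
  proof -
    note in_X_here = X(1,2) X(3)[of m] X(4)[of m] X(3)[of "Suc m"]
    let ?F = "D (F (x, y)) (F (xs m, ys m))"
    have F_step: "D (F (xs m, ys m)) (g (xs m)) \<le> K * (e (Suc m) + e m)"
      using relaxed_triangle[of "g (xs (Suc m))" "g (xs m)" "g x"] in_X_here
        commute[of "g x" "g (xs m)"] by (simp add: e_def xs)
    have F_far: "D (F (x, y)) (g (xs m)) \<le> K * (\<Delta> + e m)"
      using relaxed_triangle[of "F (x, y)" "g (xs m)" "g x"] in_X_here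
        commute[of "g x" "g (xs m)"] by (simp add: e_def \<Delta>_def)
    have "2 * ?F \<le> 2 * \<alpha>\<^sub>1 * e m + 2 * \<alpha>\<^sub>3 * f m
        + b * (\<Delta> + D (F (xs m, ys m)) (g (xs m))) + c * (D (F (x, y)) (g (xs m)) + e (Suc m))"
      using symmetric_contraction[of x y "xs m" "ys m"] in_X_here
        commute[of "g x" "g (xs m)"] commute[of "g y" "g (ys m)"]
      by (simp add: e_def f_def \<Delta>_def xs)
    also have "\<dots> \<le> 2 * \<alpha>\<^sub>1 * e m + 2 * \<alpha>\<^sub>3 * f m + b * (\<Delta> + K * (e (Suc m) + e m))
        + c * (K * (\<Delta> + e m) + e (Suc m))"
      using coeffs_nonneg F_step F_far by (intro add_mono mult_left_mono order_refl) simp_all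
    finally have "K * (2 * ?F) \<le> K * (2 * \<alpha>\<^sub>1 * e m + 2 * \<alpha>\<^sub>3 * f m
        + b * (\<Delta> + K * (e (Suc m) + e m)) + c * (K * (\<Delta> + e m) + e (Suc m)))"
      using K_ge_1 by (intro mult_left_mono) simp_all
    moreover have "\<Delta> \<le> K * (?F + e (Suc m))"
      using relaxed_triangle[of "F (x, y)" "g x" "F (xs m, ys m)"] in_X_here
      by (simp add: \<Delta>_def e_def xs)
    ultimately show ?thesis
      unfolding h_def by (simp add: algebra_simps)
  qed
  moreover have "h \<longlonglongrightarrow> K * (2 * \<alpha>\<^sub>1 * 0 + 2 * \<alpha>\<^sub>3 * 0 + b * (\<Delta> + K * (0 + 0))
      + c * (K * (\<Delta> + 0) + 0)) + 2 * K * 0"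
    unfolding h_def[abs_def] by (intro tendsto_intros e e_Suc f)
  ultimately have "2 * \<Delta> \<le> K * (b + K * c) * \<Delta>"
    using LIMSEQ_le_const[of h _ "2 * \<Delta>"] by (simp add: algebra_simps)
  then have "(2 - K * (b + K * c)) * \<Delta> \<le> 0"
    by (simp add: algebra_simps)
  then have "\<Delta> \<le> 0"
    using limit_coeff_less by (simp add: mult_le_0_iff)
  moreover have "0 \<le> \<Delta>"
    using X by (simp add: \<Delta>_def nonneg)
  ultimately show ?thesis
    using X by (intro eq_if_zero) (simp_all add: \<Delta>_def)
qed

lemma exists_coupled_iterates:
  assumes "F ` (X \<times> X) \<subseteq> g ` X"
  obtains xs ys where "\<And>m. xs m \<in> X" "\<And>m. ys m \<in> X"
    "\<And>m. g (xs (Suc m)) = F (xs m, ys m)" "\<And>m. g (ys (Suc m)) = F (ys m, xs m)"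
proof -
  have "\<exists>\<sigma>. \<forall>m. \<sigma> m \<in> X \<times> X \<and>
      (g (fst (\<sigma> (Suc m))) = F (\<sigma> m) \<and> g (snd (\<sigma> (Suc m))) = F (prod.swap (\<sigma> m)))"
  proof (rule dependent_nat_choice)
    show "\<exists>p. p \<in> X \<times> X"
      using nonempty by blast
  next
    fix p :: "'a \<times> 'a" and m :: nat
    assume "p \<in> X \<times> X"
    then have "F p \<in> g ` X" "F (prod.swap p) \<in> g ` X"
      using assms by auto
    then obtain x y where "x \<in> X" "y \<in> X" "g x = F p" "g y = F (prod.swap p)"
      by (metis imageE)
    then show "\<exists>q. q \<in> X \<times> X \<and> g (fst q) = F p \<and> g (snd q) = F (prod.swap p)"
      by (intro exI[of _ "(x, y)"]) simp
  qed
  then obtain \<sigma> where \<sigma>: "\<And>m. \<sigma> m \<in> X \<times> X" "\<And>m. g (fst (\<sigma> (Suc m))) = F (\<sigma> m)"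
    "\<And>m. g (snd (\<sigma> (Suc m))) = F (prod.swap (\<sigma> m))"
    by blast
  show thesis
    using \<sigma> by (intro that[of "\<lambda>m. fst (\<sigma> m)" "\<lambda>m. snd (\<sigma> m)"])
      (simp_all add: mem_Times_iff prod.swap_def)
qed

lemma coupled_coincidence_exists:
  assumes range: "F ` (X \<times> X) \<subseteq> g ` X" and complete: "complete_subset D (g ` X)"
  shows "\<exists>p. coupled_coincidence_point X F g p"
proof -
  obtain xs ys where X: "\<And>m. xs m \<in> X" "\<And>m. ys m \<in> X"
    and xs: "\<And>m. g (xs (Suc m)) = F (xs m, ys m)"
    and ys: "\<And>m. g (ys (Suc m)) = F (ys m, xs m)"
    using exists_coupled_iterates[OF range] by blast
  define d where "d m = D (g (xs m)) (g (xs (Suc m))) + D (g (ys m)) (g (ys (Suc m)))" for m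
  have contracts: "d (Suc m) \<le> ratio * d m" for m
    using step_sum_contracts[OF X X xs ys, of m] by (simp add: d_def xs[of "Suc m"] ys[of "Suc m"])
  have decay: "d m \<le> d 0 * ratio ^ m" for m
  proof (induction m)
    case (Suc m)
    have "d (Suc m) \<le> ratio * d m"
      by (rule contracts)
    also have "\<dots> \<le> ratio * (d 0 * ratio ^ m)"
      by (rule mult_left_mono[OF Suc.IH ratio_nonneg])
    finally show ?case by (simp add: mult.left_commute)
  qed simp
  have steps: "0 \<le> D (g (xs m)) (g (xs (Suc m)))" "0 \<le> D (g (ys m)) (g (ys (Suc m)))" for m
    using X by (simp_all add: nonneg)
  have "0 \<le> d 0"
    using steps[of 0] by (simp add: d_def)
  have geometric: "D (g (xs m)) (g (xs (Suc m))) \<le> d 0 * ratio ^ m"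
    "D (g (ys m)) (g (ys (Suc m))) \<le> d 0 * ratio ^ m" for m
    using decay[of m] steps[of m] by (simp_all add: d_def)
  have "Cauchy_seq D (\<lambda>m. g (xs m))"
    by (rule Cauchy_if_geometric_steps[OF _ geometric(1) \<open>0 \<le> d 0\<close> ratio_nonneg K_ratio_less_1])
      (simp add: X)
  moreover have "range (\<lambda>m. g (xs m)) \<subseteq> g ` X"
    using X by blast
  ultimately obtain x where x: "x \<in> X" and x_lim: "converges_to D (\<lambda>m. g (xs m)) (g x)"
    using complete unfolding complete_subset_def by blast
  have "Cauchy_seq D (\<lambda>m. g (ys m))"
    by (rule Cauchy_if_geometric_steps[OF _ geometric(2) \<open>0 \<le> d 0\<close> ratio_nonneg K_ratio_less_1])
      (simp add: X)
  moreover have "range (\<lambda>m. g (ys m)) \<subseteq> g ` X"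
    using X by blast
  ultimately obtain y where y: "y \<in> X" and y_lim: "converges_to D (\<lambda>m. g (ys m)) (g y)"
    using complete unfolding complete_subset_def by blast
  have "F (x, y) = g x"
    by (rule coincidence_in_limit[OF x y X xs x_lim y_lim])
  moreover have "F (y, x) = g y"
    by (rule coincidence_in_limit[OF y x X(2,1) ys y_lim x_lim])
  ultimately show ?thesis
    using x y by (auto simp: coupled_coincidence_point_def)
qed

end

theorem theorem6p3:
  fixes X :: "'a set" and D :: "'a \<Rightarrow> 'a \<Rightarrow> real" and K :: real and n :: nat
    and F :: "'a \<times> 'a \<Rightarrow> 'a" and g :: "'a \<Rightarrow> 'a"
    and \<alpha>\<^sub>1 \<alpha>\<^sub>2 \<alpha>\<^sub>3 \<alpha>\<^sub>4 \<alpha>\<^sub>5 \<alpha>\<^sub>6 :: real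
  assumes "metric_type_space X D K n"
    and "F \<in> X \<times> X \<rightarrow> X" and "g \<in> X \<rightarrow> X"
    and "0 \<le> \<alpha>\<^sub>1" "0 \<le> \<alpha>\<^sub>2" "0 \<le> \<alpha>\<^sub>3" "0 \<le> \<alpha>\<^sub>4" "0 \<le> \<alpha>\<^sub>5" "0 \<le> \<alpha>\<^sub>6"
    and "2 * K * (\<alpha>\<^sub>1 + \<alpha>\<^sub>3) + (K + 1) * (\<alpha>\<^sub>2 + \<alpha>\<^sub>4) + (K\<^sup>2 + K) * (\<alpha>\<^sub>5 + \<alpha>\<^sub>6) < 2"
    and "\<And>x y u v. x \<in> X \<Longrightarrow> y \<in> X \<Longrightarrow> u \<in> X \<Longrightarrow> v \<in> X \<Longrightarrow>
      D (F (x, y)) (F (u, v)) \<le> \<alpha>\<^sub>1 * D (g x) (g u) + \<alpha>\<^sub>2 * D (F (x, y)) (g x)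
        + \<alpha>\<^sub>3 * D (g y) (g v) + \<alpha>\<^sub>4 * D (F (u, v)) (g u)
        + \<alpha>\<^sub>5 * D (F (x, y)) (g u) + \<alpha>\<^sub>6 * D (F (u, v)) (g x)"
    and "F ` (X \<times> X) \<subseteq> g ` X"
    and "complete_subset D (g ` X)"
  shows "\<exists>p. coupled_coincidence_point X F g p"
proof -
  interpret coupled_contraction X D K n F g \<alpha>\<^sub>1 \<alpha>\<^sub>2 \<alpha>\<^sub>3 \<alpha>\<^sub>4 \<alpha>\<^sub>5 \<alpha>\<^sub>6
    using assms(1-11) by (intro coupled_contraction.intro coupled_contraction_axioms.intro)
  show ?thesis
    using assms(12,13) by (rule coupled_coincidence_exists)
qed

end
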